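(* Let $\mathcal{R}$ be a unital ring with involution, let $m\in\mathcal{R}$ be invertible with $m^*=m$, and let $a,b\in\mathcal{R}^{\mathrm{core},m}$. Suppose $ab\in\mathcal{R}^{\mathrm{core},m}$ and $(ab)^{\mathrm{core},m}=b^{\mathrm{core},m}a^{\mathrm{core},m}$. Then: (i) $ab=b\,b^{\mathrm{core},m}ab=b^{\mathrm{core},m}bab$; (ii) $b^{\mathrm{core},m}a\,\mathcal{R}\subseteq ab\,\mathcal{R}\subseteq ba\,\mathcal{R}$; (iii) $b\,b^{\mathrm{core},m}a^{\mathrm{core},m}\in c\{3^m,6\}$, where $c=ab\,b^{\mathrm{core},m}$.
   Context: $\mathcal{R}$ is a (not necessarily commutative) unital ring with an involution $x\mapsto x^*$ satisfying $(xy)^*=y^*x^*$, $(x+y)^*=x^*+y^*$, $(x^* )^*=x$. For an invertible $m\in\mathcal{R}$ with $m^*=m$, an element $z\in\mathcal{R}$ is the $m$-weighted core inverse of $a\in\mathcal{R}$ if $aza=a$, $z\mathcal{R}=a\mathcal{R}$ and $\mathcal{R}z=\mathcal{R}a^*m$. It is unique if it exists and is denoted $a^{\mathrm{core},m}$; $\mathcal{R}^{\mathrm{core},m}$ is the set of elements that have an $m$-weighted core inverse. For $c\in\mathcal{R}$, the set $c\{3^m,6\}$ consists of all $x\in\mathcal{R}$ with $(mcx)^*=mcx$ (condition $3^m$) and $xc^2=c$ (condition 6). *)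

theory Defs
  imports Main
begin

text \<open>
  The class extends \<open>ring\<close> and \<open>monoid_mult\<close> instead of \<open>ring_1\<close>, because \<open>ring_1\<close> demands
  \<open>0 \<noteq> 1\<close>; the zero ring is a unital ring with involution and is not excluded here.
\<close>

class involution_ring = ring + monoid_mult +
  fixes star :: "'a \<Rightarrow> 'a"  ("_\<^sup>\<star>" [1000] 999)
  assumes star_mult: "(x * y)\<^sup>\<star> = y\<^sup>\<star> * x\<^sup>\<star>"
    and star_add: "(x + y)\<^sup>\<star> = x\<^sup>\<star> + y\<^sup>\<star>"
    and star_star: "(x\<^sup>\<star>)\<^sup>\<star> = x"

definition invertible_elem :: "'a::monoid_mult \<Rightarrow> bool" where
  "invertible_elem m \<longleftrightarrow> (\<exists>m'. m * m' = 1 \<and> m' * m = 1)"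

definition right_ideal :: "'a::times \<Rightarrow> 'a set" where
  "right_ideal a = {a * r | r. True}"

definition left_ideal :: "'a::times \<Rightarrow> 'a set" where
  "left_ideal a = {r * a | r. True}"

definition is_wcore_inverse :: "'a::involution_ring \<Rightarrow> 'a \<Rightarrow> 'a \<Rightarrow> bool" where
  "is_wcore_inverse m a z \<longleftrightarrow>
     a * z * a = a \<and> right_ideal z = right_ideal a \<and> left_ideal z = left_ideal (a\<^sup>\<star> * m)"

definition wcore_invertibles :: "'a::involution_ring \<Rightarrow> 'a set" where
  "wcore_invertibles m = {a. \<exists>z. is_wcore_inverse m a z}"

text \<open>
  Meaningful only for \<open>m\<close> invertible with \<open>m\<^sup>\<star> = m\<close> and \<open>a \<in> wcore_invertibles m\<close>;
  see \<open>is_wcore_inverse_wcore_inverse\<close> below.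
\<close>

definition wcore_inverse :: "'a::involution_ring \<Rightarrow> 'a \<Rightarrow> 'a" where
  "wcore_inverse m a = (THE z. is_wcore_inverse m a z)"

text \<open>The set \<open>c{3\<^sup>m, 6}\<close>.\<close>

definition inverses_3m_6 :: "'a::involution_ring \<Rightarrow> 'a \<Rightarrow> 'a set" where
  "inverses_3m_6 m c = {x. (m * c * x)\<^sup>\<star> = m * c * x \<and> x * c\<^sup>2 = c}"

lemma is_wcore_inverseD:
  fixes a z m :: "'a::involution_ring"
  assumes "invertible_elem m" and ms: "m\<^sup>\<star> = m" and z: "is_wcore_inverse m a z"
  shows "(m * a * z)\<^sup>\<star> = m * a * z" and "z * a * z = z" and "z * a * a = a" and "\<exists>y. z = a * y"
proof -
  obtain m' where m': "m * m' = 1" "m' * m = 1"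
    using assms(1) unfolding invertible_elem_def by blast
  have aza: "a * z * a = a" and R: "right_ideal z = right_ideal a"
    and L: "left_ideal z = left_ideal (a\<^sup>\<star> * m)"
    using z unfolding is_wcore_inverse_def by auto
  have one: "(1::'a)\<^sup>\<star> = 1" by (metis star_mult star_star mult_1_left mult_1_right)
  have "z = z * 1" "a = a * 1" "z = 1 * z" "a\<^sup>\<star> * m = 1 * (a\<^sup>\<star> * m)" by simp_all
  then have "z \<in> right_ideal z" "a \<in> right_ideal a" "z \<in> left_ideal z"
    "a\<^sup>\<star> * m \<in> left_ideal (a\<^sup>\<star> * m)"
    unfolding right_ideal_def left_ideal_def by blast+
  then have "z \<in> right_ideal a" "a \<in> right_ideal z" "z \<in> left_ideal (a\<^sup>\<star> * m)"
    "a\<^sup>\<star> * m \<in> left_ideal z" using R L by auto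
  then obtain y u w v where y: "z = a * y" and u: "a = z * u" and w: "z = w * (a\<^sup>\<star> * m)"
    and v: "a\<^sup>\<star> * m = v * z"
    unfolding right_ideal_def left_ideal_def by blast
  show "\<exists>y. z = a * y" using y by blast
  have m's: "m'\<^sup>\<star> = m'"
    by (metis m' ms one star_mult mult.assoc mult_1_left mult_1_right)
  have aas: "a\<^sup>\<star> * (a * z)\<^sup>\<star> = a\<^sup>\<star>" by (metis aza star_mult)
  have "z * m' * (a * z)\<^sup>\<star> = w * a\<^sup>\<star> * (m * m') * (a * z)\<^sup>\<star>"
    by (subst w) (simp add: mult.assoc)
  also have "\<dots> = w * a\<^sup>\<star>" by (simp add: m' mult.assoc aas)
  also have "\<dots> = w * a\<^sup>\<star> * (m * m')" by (simp add: m')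
  also have "\<dots> = z * m'" using w by (simp add: mult.assoc)
  finally have e: "a * z * m' * (a * z)\<^sup>\<star> = a * z * m'" by (simp add: mult.assoc)
  have "(a * z * m' * (a * z)\<^sup>\<star>)\<^sup>\<star> = a * z * m' * (a * z)\<^sup>\<star>"
    by (simp add: star_mult star_star m's mult.assoc)
  then have h: "m' * (a * z)\<^sup>\<star> = a * z * m'" using e by (metis star_mult m's)
  have "(a * z)\<^sup>\<star> * m = m * (m' * (a * z)\<^sup>\<star>) * m" using m' by (simp flip: mult.assoc)
  also have "\<dots> = m * a * z" using h m' by (simp add: mult.assoc)
  finally have k: "(a * z)\<^sup>\<star> * m = m * a * z" .
  show "(m * a * z)\<^sup>\<star> = m * a * z" by (metis k ms star_mult mult.assoc)
  have "a\<^sup>\<star> * m * (a * z) = a\<^sup>\<star> * ((a * z)\<^sup>\<star> * m)" using k by (simp add: mult.assoc)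
  also have "\<dots> = a\<^sup>\<star> * m" by (metis aas mult.assoc)
  finally have "w * (a\<^sup>\<star> * m) * (a * z) = w * (a\<^sup>\<star> * m)" by (simp add: mult.assoc)
  then show zaz: "z * a * z = z" using w by (metis mult.assoc)
  show "z * a * a = a" by (metis zaz u mult.assoc)
qed

lemma is_wcore_inverse_unique:
  fixes a z z' m :: "'a::involution_ring"
  assumes i: "invertible_elem m" and ms: "m\<^sup>\<star> = m"
    and z: "is_wcore_inverse m a z" and z': "is_wcore_inverse m a z'"
  shows "z = z'"
proof -
  note D = is_wcore_inverseD[OF i ms z] and D' = is_wcore_inverseD[OF i ms z']
  obtain m' where m': "m' * m = 1" using i unfolding invertible_elem_def by blast
  have aza: "a * z * a = a" "a * z' * a = a" using z z' unfolding is_wcore_inverse_def by auto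
  have s: "(a * z)\<^sup>\<star> * m = m * a * z" "(a * z')\<^sup>\<star> * m = m * a * z'"
    using D(1) D'(1) by (simp_all add: star_mult ms mult.assoc)
  have "m * a * z = (a * z)\<^sup>\<star> * m" by (rule s(1)[symmetric])
  also have "\<dots> = (a * z' * a * z)\<^sup>\<star> * m" by (simp add: aza)
  also have "\<dots> = (a * z)\<^sup>\<star> * ((a * z')\<^sup>\<star> * m)" by (simp add: star_mult mult.assoc)
  also have "\<dots> = (a * z)\<^sup>\<star> * m * (a * z')" by (simp only: s(2) mult.assoc)
  also have "\<dots> = m * (a * z * a) * z'" by (simp only: s(1) flip: mult.assoc)
  also have "\<dots> = m * (a * z')" by (simp only: aza(1)) (simp add: mult.assoc)
  finally have "m * (a * z) = m * (a * z')" by (simp add: mult.assoc)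
  then have eq: "a * z = a * z'" by (metis m' mult.assoc mult_1_left)
  obtain y where y: "z' = a * y" using D'(4) by blast
  have "z = z * (a * z')" using D(2) eq by (simp add: mult.assoc)
  also have "\<dots> = z * a * a * y" by (simp add: y mult.assoc)
  also have "\<dots> = z'" by (simp add: D(3) y)
  finally show ?thesis .
qed

lemma is_wcore_inverse_wcore_inverse:
  fixes a m :: "'a::involution_ring"
  assumes "invertible_elem m" "m\<^sup>\<star> = m" "a \<in> wcore_invertibles m"
  shows "is_wcore_inverse m a (wcore_inverse m a)"
  using assms is_wcore_inverse_unique[OF assms(1,2)]
  unfolding wcore_invertibles_def wcore_inverse_def by (auto intro: theI)

end

theory Submission
  imports Defs
begin

text \<open>
  Write \<open>x\<close> and \<open>y\<close> for the weighted core inverses of \<open>a\<close> and \<open>b\<close>. Everything rests on two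
  observations. An element and its weighted core inverse generate the same right ideal, so the
  reverse order law says that \<open>a b R = y x R\<close>. And both \<open>b y\<close> and \<open>y b\<close> act as left identities on
  \<open>b R = y R\<close>.

  Since \<open>a b R = y x R \<subseteq> y R\<close>, both of them fix \<open>a b\<close>, which is the first claim. Multiplying \<open>a = x a a\<close>
  by \<open>y\<close> on the left gives \<open>y a R \<subseteq> y x R = a b R\<close>; then \<open>y a b = a b w\<close> for some \<open>w\<close>, whence
  \<open>a b = b y a b = b a b w \<in> b a R\<close>. For the third claim put \<open>c = a b y\<close>. Cancelling
  \<open>y b y = y\<close> gives \<open>c (b y x) = a b (y x)\<close>, whose product with \<open>m\<close> is symmetric because \<open>y x\<close> is the weighted
  core inverse of \<open>a b\<close>, and \<open>b y (a b) = a b\<close> together with \<open>x a a = a\<close> gives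
  \<open>b y x c\<^sup>2 = c\<close>.
\<close>

lemma mem_right_ideal_iff: "t \<in> right_ideal a \<longleftrightarrow> (\<exists>r. t = a * r)"
  by (simp add: right_ideal_def)

lemma right_ideal_subset_iff:
  fixes s t :: "'a::monoid_mult"
  shows "right_ideal s \<subseteq> right_ideal t \<longleftrightarrow> s \<in> right_ideal t"
proof
  assume "right_ideal s \<subseteq> right_ideal t"
  moreover have "s \<in> right_ideal s"
    unfolding mem_right_ideal_iff by (metis mult_1_right)
  ultimately show "s \<in> right_ideal t" by blast
next
  assume "s \<in> right_ideal t"
  then show "right_ideal s \<subseteq> right_ideal t"
    by (auto simp: mem_right_ideal_iff mult.assoc)
qed

text \<open>
  Each product fixes the generator \<open>b\<close> of the ideal: \<open>b y b = b\<close> and \<open>y b b = b\<close>.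
\<close>

lemma wcore_left_identities:
  fixes m b y t :: "'a::involution_ring"
  assumes "invertible_elem m" "m\<^sup>\<star> = m" "is_wcore_inverse m b y" and t: "t \<in> right_ideal b"
  shows "b * y * t = t" and "y * b * t = t"
proof -
  have "b * y * b = b" "y * b * b = b"
    using assms(3) is_wcore_inverseD(3)[OF assms(1-3)] by (simp_all add: is_wcore_inverse_def)
  moreover obtain r where "t = b * r" using t by (auto simp: mem_right_ideal_iff)
  ultimately show "b * y * t = t" "y * b * t = t" by (simp_all flip: mult.assoc)
qed

theorem theorem4p7:
  fixes m a b :: "'a::involution_ring"
  assumes "invertible_elem m" and "m\<^sup>\<star> = m"
    and "a \<in> wcore_invertibles m" and "b \<in> wcore_invertibles m"
    and "a * b \<in> wcore_invertibles m"
    and "wcore_inverse m (a * b) = wcore_inverse m b * wcore_inverse m a"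
  shows "(a * b = b * wcore_inverse m b * a * b \<and>
          b * wcore_inverse m b * a * b = wcore_inverse m b * b * a * b) \<and>
         (right_ideal (wcore_inverse m b * a) \<subseteq> right_ideal (a * b) \<and>
          right_ideal (a * b) \<subseteq> right_ideal (b * a)) \<and>
         b * wcore_inverse m b * wcore_inverse m a
           \<in> inverses_3m_6 m (a * b * wcore_inverse m b)"
proof -
  define x y where "x = wcore_inverse m a" and "y = wcore_inverse m b"
  have x: "is_wcore_inverse m a x" and y: "is_wcore_inverse m b y"
    and z: "is_wcore_inverse m (a * b) (y * x)"
    using is_wcore_inverse_wcore_inverse[OF assms(1,2)] assms(3-6)
    unfolding x_def y_def by metis+
  have xaa: "x * a * a = a" by (rule is_wcore_inverseD(3)[OF assms(1,2) x])
  have yby: "y * b * y = y" by (rule is_wcore_inverseD(2)[OF assms(1,2) y])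
  have ideal_b: "right_ideal y = right_ideal b"
    and ideal_ab: "right_ideal (y * x) = right_ideal (a * b)"
    using y z by (simp_all add: is_wcore_inverse_def)

  have "right_ideal (y * x) \<subseteq> right_ideal y"
    unfolding right_ideal_subset_iff mem_right_ideal_iff by blast
  then have "a * b \<in> right_ideal b"
    unfolding ideal_b ideal_ab right_ideal_subset_iff .
  note left_id = wcore_left_identities[OF assms(1,2) y this]

  have "y * a = y * x * (a * a)" using xaa by (simp add: mult.assoc)
  then have "y * a \<in> right_ideal (y * x)" unfolding mem_right_ideal_iff by blast
  then have ya: "y * a \<in> right_ideal (a * b)" by (simp add: ideal_ab)

  obtain w where w: "y * a = a * b * w" using ya by (auto simp: mem_right_ideal_iff)
  have "a * b = b * (y * a) * b" using left_id(1) by (simp add: mult.assoc)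
  also have "\<dots> = b * a * (b * w * b)" by (simp add: w mult.assoc)
  finally have ab: "a * b \<in> right_ideal (b * a)" unfolding mem_right_ideal_iff by blast

  let ?c = "a * b * y" and ?X = "b * y * x"
  have "m * ?c * ?X = m * (a * b) * ((y * b * y) * x)" by (simp only: mult.assoc)
  also have "\<dots> = m * (a * b) * (y * x)" by (simp only: yby)
  finally have sym: "(m * ?c * ?X)\<^sup>\<star> = m * ?c * ?X"
    using is_wcore_inverseD(1)[OF assms(1,2) z] by simp
  have "?X * ?c\<^sup>2 = b * y * x * a * (b * y * (a * b)) * y"
    by (simp only: power2_eq_square mult.assoc)
  also have "\<dots> = b * y * (x * a * a) * b * y" by (simp only: left_id(1)) (simp only: mult.assoc)
  also have "\<dots> = b * y * (a * b) * y" by (simp only: xaa) (simp only: mult.assoc)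
  also have "\<dots> = ?c" by (simp only: left_id(1))
  finally have "?X \<in> inverses_3m_6 m ?c" using sym by (simp add: inverses_3m_6_def)
  moreover have "a * b = b * y * a * b" "b * y * a * b = y * b * a * b"
    using left_id by (simp_all add: mult.assoc)
  ultimately show ?thesis
    unfolding right_ideal_subset_iff x_def[symmetric] y_def[symmetric] using ya ab by blast
qed

end
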